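(* Let $d\ge 1$ and let $(S_n)_{n\ge 0}$ be a transient random walk in $\mathbb{Z}^d$ with escape probability $\gamma\in(0,1)$. Then for any real $\alpha\ge 0$, $$\frac{L_n(\alpha)}{n}\ \to\ \gamma^2\sum_{j=1}^\infty j^\alpha(1-\gamma)^{j-1}\qquad\text{as } n\to\infty,$$ both in mean square (in $L_2$) and with probability $1$.
   Context: $X_1,X_2,\ldots$ are independent identically distributed random vectors with values in $\mathbb{Z}^d$; $S_0:=0$ and $S_n:=X_1+\cdots+X_n$. No moment or other assumptions are made on $X_1$. The escape probability is $\gamma:=\mathbb{P}\{S_n\ne 0\text{ for all } n\ge 1\}$; the walk is transient if $\gamma>0$, and it is assumed throughout that also $\gamma<1$. The local time of $x\in\mathbb{Z}^d$ up to time $n$ is $l(n,x):=\sum_{i=0}^n \mathbf{1}\{S_i=x\}$, and $L_n(\alpha):=\sum_{x\in\mathbb{Z}^d:\ l(n,x)>0} l(n,x)^\alpha$. *)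

theory Defs
  imports "HOL-Probability.Probability"
begin

text \<open>The lattice is \<open>int ^ 'd\<close>, so the dimension is \<open>CARD('d) \<ge> 1\<close>. The steps are
  \<open>X 1, X 2, \<dots>\<close>; the value \<open>X 0\<close> is never used. Measurability of the steps is part of
  \<^const>\<open>prob_space.indep_vars\<close>.\<close>

locale random_walk = prob_space M
  for M :: "'a measure" +
  fixes X :: "nat \<Rightarrow> 'a \<Rightarrow> int ^ 'd::finite"
  assumes indep: "indep_vars (\<lambda>_. count_space UNIV) X {1..}"
    and ident_distr:
      "\<And>i. i \<ge> 1 \<Longrightarrow> distr M (count_space UNIV) (X i) = distr M (count_space UNIV) (X 1)"

definition walk :: "(nat \<Rightarrow> 'a \<Rightarrow> int ^ 'd::finite) \<Rightarrow> nat \<Rightarrow> 'a \<Rightarrow> int ^ 'd" where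
  "walk X n \<omega> = (\<Sum>i=1..n. X i \<omega>)"

definition escape_prob :: "'a measure \<Rightarrow> (nat \<Rightarrow> 'a \<Rightarrow> int ^ 'd::finite) \<Rightarrow> real" where
  "escape_prob M X = measure M {\<omega> \<in> space M. \<forall>n\<ge>1. walk X n \<omega> \<noteq> 0}"

definition transient_walk :: "'a measure \<Rightarrow> (nat \<Rightarrow> 'a \<Rightarrow> int ^ 'd::finite) \<Rightarrow> bool" where
  "transient_walk M X \<longleftrightarrow> escape_prob M X > 0"

definition local_time ::
    "(nat \<Rightarrow> 'a \<Rightarrow> int ^ 'd::finite) \<Rightarrow> nat \<Rightarrow> int ^ 'd \<Rightarrow> 'a \<Rightarrow> nat" where
  "local_time X n x \<omega> = (\<Sum>i=0..n. of_bool (walk X i \<omega> = x))"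

text \<open>Only finitely many sites have positive local time. As the sum ranges over these sites only,
  the convention \<open>0 powr 0 = 0\<close> plays no role: for \<open>\<alpha> = 0\<close> the sum counts the visited sites.\<close>

definition local_time_power_sum ::
    "(nat \<Rightarrow> 'a \<Rightarrow> int ^ 'd::finite) \<Rightarrow> real \<Rightarrow> nat \<Rightarrow> 'a \<Rightarrow> real" where
  "local_time_power_sum X \<alpha> n \<omega> =
     (\<Sum>x | local_time X n x \<omega> > 0. real (local_time X n x \<omega>) powr \<alpha>)"

text \<open>Square integrability is demanded explicitly because the Bochner integral of a
  non-integrable function is \<open>0\<close>.\<close>

definition tendsto_L2 :: "'a measure \<Rightarrow> (nat \<Rightarrow> 'a \<Rightarrow> real) \<Rightarrow> ('a \<Rightarrow> real) \<Rightarrow> bool" where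
  "tendsto_L2 M Y Z \<longleftrightarrow>
     (\<forall>n. Y n \<in> borel_measurable M \<and> integrable M (\<lambda>\<omega>. (Y n \<omega>)\<^sup>2)) \<and>
     Z \<in> borel_measurable M \<and> integrable M (\<lambda>\<omega>. (Z \<omega>)\<^sup>2) \<and>
     (\<lambda>n. \<integral>\<omega>. (Y n \<omega> - Z \<omega>)\<^sup>2 \<partial>M) \<longlonglongrightarrow> 0"

end

theory Submission
  imports Defs "HOL-Real_Asymp.Real_Asymp"
begin

text \<open>Put \<open>f k = k powr \<alpha>\<close>. Counting the visits to a site backwards in time telescopes \<open>f (l(n,x))\<close>
  into the increments of \<open>f\<close> at the numbers of visits still to come, so that
  \<open>L\<^sub>n(\<alpha>) = (\<Sum>i\<le>n. f (1 + C) - f C)\<close> where \<open>C\<close> is the number of returns to \<open>S\<^sub>i\<close> during \<open>{i<..n}\<close>.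
  Replacing \<open>C\<close> by the total number of returns after time \<open>i\<close>, which is geometrically distributed,
  turns the sum into a Birkhoff sum for the shift on the sequence of steps, whose averages converge
  almost surely to the stated constant. The error only comes from times \<open>i\<close> in \<open>{n - m<..n}\<close> and from
  walks returning to \<open>S\<^sub>i\<close> after time \<open>i + m\<close>; the latter form a Birkhoff sum whose mean is small for
  large \<open>m\<close>. Fourth moments of \<open>L\<^sub>n(\<alpha>) / n\<close> are bounded, which upgrades almost sure convergence to
  convergence in mean square.\<close>

section \<open>The ergodic theorem for the shift on an i.i.d. sequence\<close>

definition seq_shift :: "nat \<Rightarrow> (nat \<Rightarrow> 'b) \<Rightarrow> nat \<Rightarrow> 'b" where
  "seq_shift k s = (\<lambda>i. s (k + i))"

lemma seq_shift_0 [simp]: "seq_shift 0 s = s"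
  by (simp add: seq_shift_def)

lemma seq_shift_seq_shift [simp]: "seq_shift j (seq_shift k s) = seq_shift (k + j) s"
  by (simp add: seq_shift_def add.assoc)

definition birkhoff_sum :: "((nat \<Rightarrow> 'b) \<Rightarrow> real) \<Rightarrow> nat \<Rightarrow> (nat \<Rightarrow> 'b) \<Rightarrow> real" where
  "birkhoff_sum F n s = (\<Sum>k<n. F (seq_shift k s))"

lemma birkhoff_sum_Suc: "birkhoff_sum F (Suc n) s = F s + birkhoff_sum F n (seq_shift 1 s)"
  unfolding birkhoff_sum_def by (subst sum.lessThan_Suc_shift) simp

section \<open>Stationarity of the shift and the zero-one law\<close>

context sequence_space
begin

lemma measurable_seq_shift [measurable]: "seq_shift k \<in> measurable S S"
  unfolding seq_shift_def by (rule measurable_PiM_single') (auto simp: space_PiM PiE_iff)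

text \<open>The product measure is the image of two independent copies under
  \<open>comb_seq k\<close>, which puts the first \<open>k\<close> entries of one sequence in front
  of the other. Shifting by \<open>k\<close> undoes the gluing and leaves the second projection,
  whose law is the product measure again.\<close>

lemma distr_shift: "distr S S (seq_shift k) = S"
proof -
  have "seq_shift k (comb_seq k \<omega> \<omega>') = \<omega>'" for \<omega> \<omega>' :: "nat \<Rightarrow> 'a"
    by (simp add: seq_shift_def comb_seq_def)
  then have *: "seq_shift k \<circ> (\<lambda>(\<omega>, \<omega>'). comb_seq k \<omega> \<omega>') = (snd :: _ \<times> (nat \<Rightarrow> 'a) \<Rightarrow> _)"
    by (auto simp: fun_eq_iff)
  have "distr S S (seq_shift k) = distr (distr (S \<Otimes>\<^sub>M S) S (\<lambda>(\<omega>, \<omega>'). comb_seq k \<omega> \<omega>')) S (seq_shift k)"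
    by (simp add: PiM_comb_seq)
  also have "\<dots> = distr (S \<Otimes>\<^sub>M S) S snd"
    by (subst distr_distr) (simp_all add: *)
  also have "\<dots> = S"
  proof (rule measure_eqI)
    fix A assume A: "A \<in> sets (distr (S \<Otimes>\<^sub>M S) S snd)"
    then have "snd -` A \<inter> space (S \<Otimes>\<^sub>M S) = space S \<times> A"
      by (auto simp: space_pair_measure dest: sets.sets_into_space)
    with A show "emeasure (distr (S \<Otimes>\<^sub>M S) S snd) A = emeasure S A"
      by (simp add: emeasure_distr P.emeasure_pair_measure_Times P.emeasure_space_1)
  qed simp
  finally show ?thesis .
qed

lemma integral_shift:
  fixes F :: "(nat \<Rightarrow> 'a) \<Rightarrow> real"
  assumes [measurable]: "F \<in> borel_measurable S"
  shows "(\<integral>s. F (seq_shift k s) \<partial>S) = (\<integral>s. F s \<partial>S)"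
  using integral_distr[of "seq_shift k" S S F] by (simp add: distr_shift)

lemma integrable_shift:
  fixes F :: "(nat \<Rightarrow> 'a) \<Rightarrow> real"
  assumes "integrable S F"
  shows "integrable S (\<lambda>s. F (seq_shift k s))"
  using integrable_distr[of "seq_shift k" S S F] assms by (simp add: distr_shift)

lemma AE_shift:
  assumes "AE s in S. Q s"
  shows "AE s in S. Q (seq_shift k s)"
proof (rule AE_distrD[OF measurable_seq_shift])
  show "AE s in distr S S (seq_shift k). Q s"
    unfolding distr_shift by (rule assms)
qed

lemma birkhoff_sum_measurable [measurable]:
  assumes [measurable]: "F \<in> borel_measurable S"
  shows "birkhoff_sum F n \<in> borel_measurable S"
  unfolding birkhoff_sum_def by measurable

lemma integrable_birkhoff_sum:
  assumes "integrable S F"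
  shows "integrable S (birkhoff_sum F n)"
  unfolding birkhoff_sum_def using assms by (intro Bochner_Integration.integrable_sum integrable_shift)

lemma integral_birkhoff_sum:
  assumes "integrable S F"
  shows "(\<integral>s. birkhoff_sum F n s \<partial>S) = n * (\<integral>s. F s \<partial>S)"
  unfolding birkhoff_sum_def using assms by (simp add: integrable_shift integral_shift)

lemma indep_vars_coordinate: "P.indep_vars (\<lambda>_. M) (\<lambda>i s. s i) UNIV"
  by (subst P.indep_vars_iff_distr_eq_PiM) (simp_all add: PiM_component restrict_def)

text \<open>Invariance iterates: the event coincides with its preimage under the shift by
  \<open>n\<close>, hence is determined by the coordinates from \<open>n\<close> on. As
  \<open>n\<close> is arbitrary it is a tail event, and Kolmogorov's law applies to the independent
  coordinates.\<close>

lemma shift_invariant_0_1: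
  assumes A [measurable]: "A \<in> sets S"
    and inv: "\<And>s. s \<in> space S \<Longrightarrow> seq_shift 1 s \<in> A \<longleftrightarrow> s \<in> A"
  shows "P.prob A = 0 \<or> P.prob A = 1"
proof (rule P.kolmogorov_0_1_law)
  let ?A = "\<lambda>i. {(\<lambda>s. s i) -` B \<inter> space S |B. B \<in> sets M}"
  show "sigma_algebra (space S) (?A i)" for i
    using sets.sigma_algebra_axioms[of "vimage_algebra (space S) (\<lambda>s. s i) M"]
    by (subst (asm) sets_vimage_algebra2) (auto simp: space_PiM)
  show "P.indep_sets ?A UNIV"
    using indep_vars_coordinate by (simp add: P.indep_vars_def2)
  show "A \<in> P.tail_events ?A"
    unfolding P.tail_events_def
  proof
    fix n
    let ?N = "sigma (space S) (\<Union>i\<in>{n..}. ?A i)"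
    have sub: "(\<Union>i\<in>{n..}. ?A i) \<subseteq> Pow (space S)" by auto
    have inv_n: "s \<in> space S \<Longrightarrow> seq_shift n s \<in> A \<longleftrightarrow> s \<in> A" for s
    proof (induction n)
      case (Suc n)
      then show ?case using inv[of "seq_shift n s"] measurable_space[OF measurable_seq_shift] by simp
    qed simp
    \<comment> \<open>Coordinate \<open>i\<close> of the shifted sequence is coordinate
      \<open>n + i\<close> of the original one, so only the sigma-algebra of the coordinates from
      \<open>n\<close> on is used.\<close>
    have "seq_shift n \<in> measurable ?N S"
      unfolding seq_shift_def
    proof (rule measurable_PiM_single')
      fix i :: nat
      show "(\<lambda>s. s (n + i)) \<in> measurable ?N M"
      proof (rule measurableI)
        fix B assume "B \<in> sets M"
        then have "(\<lambda>s. s (n + i)) -` B \<inter> space S \<in> (\<Union>i\<in>{n..}. ?A i)"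
          by (intro UN_I[of "n + i"]) auto
        then show "(\<lambda>s. s (n + i)) -` B \<inter> space ?N \<in> sets ?N"
          using sub by simp
      qed (use sub in \<open>auto simp: space_PiM\<close>)
    qed (use sub in \<open>auto simp: space_PiM PiE_iff\<close>)
    then have "seq_shift n -` A \<inter> space ?N \<in> sets ?N"
      using A by (rule measurable_sets)
    also have "seq_shift n -` A \<inter> space ?N = A"
      using inv_n sub sets.sets_into_space[OF A] by auto
    finally show "A \<in> sigma_sets (space S) (\<Union>i\<in>{n..}. ?A i)"
      using sub by simp
  qed
qed

section \<open>The maximal inequality\<close>

definition max_birkhoff :: "((nat \<Rightarrow> 'a) \<Rightarrow> real) \<Rightarrow> nat \<Rightarrow> (nat \<Rightarrow> 'a) \<Rightarrow> real" where
  "max_birkhoff F n s = Max ((\<lambda>k. birkhoff_sum F k s) ` {..n})"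

lemma max_birkhoff_Suc:
  "max_birkhoff F (Suc n) s = max (birkhoff_sum F (Suc n) s) (max_birkhoff F n s)"
  unfolding max_birkhoff_def by (simp add: atMost_Suc)

lemma integrable_max_birkhoff:
  assumes "integrable S F"
  shows "integrable S (max_birkhoff F n)"
proof (induction n)
  case 0
  show ?case by (simp add: max_birkhoff_def birkhoff_sum_def)
next
  case (Suc n)
  then show ?case
    unfolding max_birkhoff_Suc using assms by (intro integrable_max integrable_birkhoff_sum)
qed

lemma max_birkhoff_ge: "k \<le> n \<Longrightarrow> birkhoff_sum F k s \<le> max_birkhoff F n s"
  unfolding max_birkhoff_def by (rule Max_ge) auto

lemma max_birkhoff_nonneg: "0 \<le> max_birkhoff F n s"
  using max_birkhoff_ge[of 0 n F s] by (simp add: birkhoff_sum_def)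

text \<open>Garsia's argument: the drop of the running maximum from a sequence to its shift is at
  most \<open>F\<close> where the maximum is positive and at most 0 elsewhere, while its integral
  vanishes by stationarity.\<close>

lemma maximal_ergodic:
  assumes F: "integrable S F"
  shows "0 \<le> (\<integral>s. F s * indicator {s \<in> space S. max_birkhoff F n s > 0} s \<partial>S)"
proof -
  have [measurable]: "F \<in> borel_measurable S" "max_birkhoff F n \<in> borel_measurable S"
    using F integrable_max_birkhoff[OF F, of n] by auto
  have "max_birkhoff F n s - max_birkhoff F n (seq_shift 1 s)
      \<le> F s * indicator {s \<in> space S. max_birkhoff F n s > 0} s" if s: "s \<in> space S" for s
  proof (cases "max_birkhoff F n s > 0")
    case True
    obtain k where k: "k \<le> n" "max_birkhoff F n s = birkhoff_sum F k s"
      using Max_in[of "(\<lambda>k. birkhoff_sum F k s) ` {..n}"] unfolding max_birkhoff_def by fastforce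
    \<comment> \<open>The empty sum at index 0 is 0, so a positive maximum is attained at a
      successor. Splitting off \<open>F s\<close> leaves a sum of length \<open>j\<close> along the
      shifted sequence, which its own maximum dominates.\<close>
    with True obtain j where "k = Suc j"
      by (cases k) (auto simp: birkhoff_sum_def)
    then show ?thesis
      using True s k max_birkhoff_ge[of j n F "seq_shift 1 s"] by (simp add: birkhoff_sum_Suc)
  qed (use max_birkhoff_nonneg[of F n "seq_shift 1 s"] in auto)
  then have "(\<integral>s. max_birkhoff F n s - max_birkhoff F n (seq_shift 1 s) \<partial>S)
      \<le> (\<integral>s. F s * indicator {s \<in> space S. max_birkhoff F n s > 0} s \<partial>S)"
    using F by (intro integral_mono integrable_real_mult_indicator
      Bochner_Integration.integrable_diff integrable_shift integrable_max_birkhoff) auto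
  also have "(\<integral>s. max_birkhoff F n s - max_birkhoff F n (seq_shift 1 s) \<partial>S) = 0"
    using F by (subst Bochner_Integration.integral_diff)
      (auto intro!: integrable_shift integrable_max_birkhoff simp: integral_shift)
  finally show ?thesis .
qed

text \<open>Unboundedness above is a shift-invariant event, so it has probability 0 or 1; probability 1 would
  make the indicators in the maximal inequality tend to 1 and force a nonnegative mean.\<close>

lemma birkhoff_sum_bounded_above:
  assumes F: "integrable S F" and neg: "(\<integral>s. F s \<partial>S) < 0"
  shows "AE s in S. \<exists>K::nat. \<forall>n. birkhoff_sum F n s \<le> K"
proof -
  have [measurable]: "F \<in> borel_measurable S" "max_birkhoff F n \<in> borel_measurable S" for n
    using F integrable_max_birkhoff[OF F, of n] by auto
  define E where "E = {s \<in> space S. \<forall>K::nat. \<exists>n. birkhoff_sum F n s > K}"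
  have E [measurable]: "E \<in> sets S"
    unfolding E_def by measurable
  have "P.prob E = 0 \<or> P.prob E = 1"
  proof (rule shift_invariant_0_1[OF E])
    fix s assume s: "s \<in> space S"
    have "(\<forall>K::nat. \<exists>n. birkhoff_sum F n (seq_shift 1 s) > K) \<longleftrightarrow> (\<forall>K::nat. \<exists>n. birkhoff_sum F n s > K)"
      (is "?L \<longleftrightarrow> ?R")
    proof
      assume L: ?L
      show ?R
      proof
        fix K :: nat
        \<comment> \<open>Sums along the sequence and along its shift differ by the first term only,
          so raising the threshold by a natural number above its absolute value makes up for
          it.\<close>
        obtain n where "birkhoff_sum F n (seq_shift 1 s) > K + nat \<lceil>\<bar>F s\<bar>\<rceil>"
          using L by blast
        then have "birkhoff_sum F (Suc n) s > K"
          unfolding birkhoff_sum_Suc by linarith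
        then show "\<exists>n. birkhoff_sum F n s > K" ..
      qed
    next
      assume R: ?R
      show ?L
      proof
        fix K :: nat
        obtain n where n: "birkhoff_sum F n s > K + nat \<lceil>\<bar>F s\<bar>\<rceil>"
          using R by blast
        \<comment> \<open>The empty sum is 0 and cannot exceed a natural number.\<close>
        then obtain m where m: "n = Suc m"
          by (cases n) (simp add: birkhoff_sum_def, linarith, simp)
        then have "birkhoff_sum F m (seq_shift 1 s) > K"
          using n unfolding m birkhoff_sum_Suc by linarith
        then show "\<exists>n. birkhoff_sum F n (seq_shift 1 s) > K" ..
      qed
    qed
    then show "seq_shift 1 s \<in> E \<longleftrightarrow> s \<in> E"
      using s measurable_space[OF measurable_seq_shift s] by (simp add: E_def)
  qed
  moreover have "P.prob E \<noteq> 1"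
  proof
    assume "P.prob E = 1"
    then have AE_E: "AE s in S. s \<in> E"
      by (simp add: P.AE_in_set_eq_1)
    have "(\<lambda>n. \<integral>s. F s * indicator {s \<in> space S. max_birkhoff F n s > 0} s \<partial>S) \<longlonglongrightarrow> (\<integral>s. F s \<partial>S)"
    proof (rule integral_dominated_convergence[where w="\<lambda>s. \<bar>F s\<bar>"])
      show "AE s in S. (\<lambda>n. F s * indicator {s \<in> space S. max_birkhoff F n s > 0} s) \<longlonglongrightarrow> F s"
        using AE_E
      proof eventually_elim
        case (elim s)
        then obtain m where m: "birkhoff_sum F m s > 0" "s \<in> space S"
          unfolding E_def by (auto dest!: spec[where x="0::nat"])
        show ?case
        proof (rule tendsto_eventually, rule eventually_sequentiallyI[of m])
          fix n assume "m \<le> n"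
          then show "F s * indicator {s \<in> space S. max_birkhoff F n s > 0} s = F s"
            using m max_birkhoff_ge[of m n F s] by simp
        qed
      qed
    qed (use F in \<open>auto simp: indicator_def\<close>)
    then have "0 \<le> (\<integral>s. F s \<partial>S)"
      using maximal_ergodic[OF F] by (intro LIMSEQ_le_const) auto
    then show False using neg by simp
  qed
  ultimately have "P.prob E = 0" by simp
  then have "AE s in S. s \<notin> E"
    by (simp add: P.prob_eq_0)
  then show ?thesis
    using AE_space by eventually_elim (auto simp: E_def not_less)
qed

text \<open>After subtracting the mean and \<open>1 / Suc j\<close> the function has negative mean,
  so its sums stay below a random constant, which division by \<open>n\<close> sends to 0. Taking
  only countably many margins keeps the exceptional set null.\<close>

lemma birkhoff_upper:
  assumes F: "integrable S F"
  shows "AE s in S. \<forall>e>0. \<forall>\<^sub>F n in sequentially. birkhoff_sum F n s / n < (\<integral>s. F s \<partial>S) + e"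
proof -
  let ?I = "\<integral>s. F s \<partial>S"
  have "AE s in S. \<exists>K::nat. \<forall>n. birkhoff_sum (\<lambda>s. F s - ?I - 1 / real (Suc j)) n s \<le> K" for j
    using F by (intro birkhoff_sum_bounded_above) (auto simp: P.prob_space)
  then have "AE s in S. \<forall>j. \<exists>K::nat. \<forall>n. birkhoff_sum (\<lambda>s. F s - ?I - 1 / real (Suc j)) n s \<le> K"
    by (simp add: AE_all_countable)
  then show ?thesis
  proof eventually_elim
    case (elim s)
    show ?case
    proof (intro allI impI)
      fix e :: real assume "e > 0"
      then obtain j where j: "1 / real (Suc j) < e"
        using nat_approx_posE by blast
      obtain K :: nat where K: "birkhoff_sum (\<lambda>s. F s - ?I - 1 / real (Suc j)) n s \<le> K" for n
        using elim by blast
      have "(\<lambda>n. ?I + 1 / real (Suc j) + K / real n) \<longlonglongrightarrow> ?I + 1 / real (Suc j) + 0"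
        by (intro tendsto_intros lim_const_over_n)
      then have "\<forall>\<^sub>F n in sequentially. ?I + 1 / real (Suc j) + K / real n < ?I + e"
        using j by (intro order_tendstoD(2)) auto
      then show "\<forall>\<^sub>F n in sequentially. birkhoff_sum F n s / n < ?I + e"
        using eventually_gt_at_top[of 0]
      proof eventually_elim
        case (elim n)
        have "birkhoff_sum (\<lambda>s. F s - ?I - 1 / real (Suc j)) n s
          = birkhoff_sum F n s - n * (?I + 1 / real (Suc j))"
          by (simp add: birkhoff_sum_def sum_subtractf algebra_simps)
        then have "birkhoff_sum F n s \<le> n * (?I + 1 / real (Suc j)) + K"
          using K[of n] by simp
        then have "birkhoff_sum F n s / n \<le> (n * (?I + 1 / real (Suc j)) + K) / n"
          by (rule divide_right_mono) simp
        also have "\<dots> = ?I + 1 / real (Suc j) + K / real n"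
          using elim by (simp add: add_divide_distrib)
        finally have "birkhoff_sum F n s / n \<le> ?I + 1 / real (Suc j) + K / real n" .
        then show ?case using elim by simp
      qed
    qed
  qed
qed

text \<open>The lower bound is the upper bound for \<open>- F\<close>.\<close>

theorem birkhoff:
  assumes F: "integrable S F"
  shows "AE s in S. (\<lambda>n. birkhoff_sum F n s / n) \<longlonglongrightarrow> (\<integral>s. F s \<partial>S)"
proof -
  have "integrable S (\<lambda>s. - F s)" using F by simp
  from birkhoff_upper[OF F] birkhoff_upper[OF this] show ?thesis
  proof eventually_elim
    case (elim s)
    show ?case
    proof (rule order_tendstoI)
      fix a assume "a < (\<integral>s. F s \<partial>S)"
      then have "\<forall>\<^sub>F n in sequentially. birkhoff_sum (\<lambda>s. - F s) n s / n
          < (\<integral>s. - F s \<partial>S) + ((\<integral>s. F s \<partial>S) - a)"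
        using elim(2)[rule_format, of "(\<integral>s. F s \<partial>S) - a"] by simp
      then show "\<forall>\<^sub>F n in sequentially. a < birkhoff_sum F n s / n"
        by eventually_elim (simp add: birkhoff_sum_def sum_negf)
    next
      fix a assume "(\<integral>s. F s \<partial>S) < a"
      then show "\<forall>\<^sub>F n in sequentially. birkhoff_sum F n s / n < a"
        using elim(1)[rule_format, of "a - (\<integral>s. F s \<partial>S)"] by simp
    qed
  qed
qed

end

section \<open>Returns to the origin\<close>

definition partial_sum :: "nat \<Rightarrow> (nat \<Rightarrow> 'b::ab_group_add) \<Rightarrow> 'b" where
  "partial_sum n s = (\<Sum>i<n. s i)"

definition returns :: "(nat \<Rightarrow> 'b::ab_group_add) \<Rightarrow> nat set" where
  "returns s = {n. 1 \<le> n \<and> partial_sum n s = 0}"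

definition first_return :: "nat \<Rightarrow> (nat \<Rightarrow> 'b::ab_group_add) \<Rightarrow> bool" where
  "first_return m s \<longleftrightarrow> m \<in> returns s \<and> (\<forall>j<m. j \<notin> returns s)"

text \<open>\<open>card\<close> is 0 on infinite sets, hence the separate disjunct for infinitely
  many returns.\<close>

definition returns_at_least :: "nat \<Rightarrow> (nat \<Rightarrow> 'b::ab_group_add) \<Rightarrow> bool" where
  "returns_at_least k s \<longleftrightarrow> infinite (returns s) \<or> k \<le> card (returns s)"

definition power_sum :: "(nat \<Rightarrow> real) \<Rightarrow> nat \<Rightarrow> (nat \<Rightarrow> 'b::ab_group_add) \<Rightarrow> real" where
  "power_sum f n s =
    (\<Sum>x\<in>(\<lambda>i. partial_sum i s) ` {..n}. f (card {i. i \<le> n \<and> partial_sum i s = x}))"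

section \<open>Renewal structure of the return times and backward counting of visits\<close>

lemma partial_sum_add: "partial_sum (m + n) s = partial_sum m s + partial_sum n (seq_shift m s)"
  by (induction n) (simp_all add: partial_sum_def seq_shift_def)

lemma mem_returns_seq_shift:
  "n \<in> returns (seq_shift m s) \<longleftrightarrow> 1 \<le> n \<and> partial_sum (m + n) s = partial_sum m s"
  by (simp add: returns_def partial_sum_add)

text \<open>At time \<open>m\<close> the walk is back at the origin, so its later returns are those
  of the shifted walk, delayed by \<open>m\<close>.\<close>

lemma returns_first_return:
  assumes "first_return m s"
  shows "returns s = insert m ((+) m ` returns (seq_shift m s))"
proof -
  have m: "1 \<le> m" "partial_sum m s = 0" "\<And>j. j \<in> returns s \<Longrightarrow> m \<le> j"
    using assms by (auto simp: first_return_def returns_def not_less[symmetric])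
  have "n \<in> returns s \<longleftrightarrow> n = m \<or> n \<in> (+) m ` returns (seq_shift m s)" for n
  proof (cases "m < n")
    case True
    then obtain j where "n = m + j" "1 \<le> j"
      by (metis less_imp_add_positive Suc_leI One_nat_def)
    then show ?thesis
      using m by (auto simp: image_iff mem_returns_seq_shift) (simp add: returns_def)+
  next
    case False
    then show ?thesis
      using m by (force simp: returns_def)
  qed
  then show ?thesis by blast
qed

text \<open>Deleting the first return lowers the number of returns by one and restarts the walk.
  Since the first return time is unique, this is a disjoint decomposition of the event.\<close>

lemma returns_at_least_Suc:
  "returns_at_least (Suc k) s \<longleftrightarrow> (\<exists>m. first_return m s \<and> returns_at_least k (seq_shift m s))"
proof -
  have "returns_at_least (Suc k) s \<longleftrightarrow> returns_at_least k (seq_shift m s)" if "first_return m s" for m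
  proof -
    let ?R = "returns (seq_shift m s)"
    \<comment> \<open>Return times are at least 1, so the delayed ones lie strictly after
      \<open>m\<close> and the insertion really adds an element.\<close>
    have "m \<notin> (+) m ` ?R"
      by (auto simp: returns_def)
    then have "card (insert m ((+) m ` ?R)) = Suc (card ?R)" if "finite ?R"
      using that by (simp add: card_image)
    moreover have "finite ((+) m ` ?R) \<longleftrightarrow> finite ?R"
      by (simp add: finite_image_iff)
    ultimately show ?thesis
      unfolding returns_at_least_def returns_first_return[OF that] by auto
  qed
  moreover have "\<exists>m. first_return m s" if "returns_at_least (Suc k) s"
  proof -
    have "\<exists>m. m \<in> returns s"
      using that by (cases "returns s = {}") (auto simp: returns_at_least_def)
    then have "first_return (LEAST m. m \<in> returns s) s"
      by (auto simp: first_return_def intro: LeastI dest: not_less_Least)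
    then show ?thesis ..
  qed
  ultimately show ?thesis by blast
qed

text \<open>The event is decided by the first \<open>m\<close> steps, which makes it independent of
  the walk restarted at time \<open>m\<close>.\<close>

lemma first_return_past:
  assumes "\<And>i. i < m \<Longrightarrow> s i = s' i"
  shows "first_return m s \<longleftrightarrow> first_return m s'"
proof -
  have "partial_sum j s = partial_sum j s'" if "j \<le> m" for j
    unfolding partial_sum_def using that assms by (intro sum.cong) auto
  then have "j \<in> returns s \<longleftrightarrow> j \<in> returns s'" if "j \<le> m" for j
    using that by (simp add: returns_def)
  then show ?thesis
    by (simp add: first_return_def)
qed

lemma first_return_unique: "first_return m s \<Longrightarrow> first_return n s \<Longrightarrow> m = n"
  by (auto simp: first_return_def dest: linorder_neqE_nat)

text \<open>Counted from the top, the elements of \<open>A\<close> have ranks \<open>card A\<close>,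
  ..., 1, so the increments telescope down to \<open>f 0\<close>. The induction adds a new minimum
  because this leaves all other ranks unchanged.\<close>

lemma sum_telescope_card_ge:
  fixes f :: "nat \<Rightarrow> real"
  assumes "finite A" "f 0 = 0"
  shows "(\<Sum>i\<in>A. f (card {k\<in>A. i \<le> k}) - f (card {k\<in>A. i \<le> k} - 1)) = f (card (A :: nat set))"
  using assms(1)
proof (induction A rule: finite_linorder_min_induct)
  case (insert b A)
  have "{k \<in> insert b A. i \<le> k} = {k\<in>A. i \<le> k}" if "i \<in> A" for i
    using insert that by auto
  moreover have "{k \<in> insert b A. b \<le> k} = insert b A" "b \<notin> A"
    using insert by auto
  ultimately show ?case
    using insert by simp
qed (simp add: assms)

text \<open>Each visit contributes the increment of \<open>f\<close> at the number of visits still to come, so that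
  the summand of time \<open>i\<close> depends on the future of the walk only.\<close>

lemma power_sum_eq_increments:
  assumes "f 0 = 0"
  shows "power_sum f n s = (\<Sum>i\<le>n. f (Suc (card (returns (seq_shift i s) \<inter> {..n - i})))
    - f (card (returns (seq_shift i s) \<inter> {..n - i})))"
proof -
  define V where "V x = {i. i \<le> n \<and> partial_sum i s = x}" for x
  \<comment> \<open>The visits to the site of time \<open>i\<close> from then on are time
    \<open>i\<close> itself, giving the \<open>Suc\<close>, and the returns of the restarted walk,
    delayed by \<open>i\<close>.\<close>
  have card_V: "card {k \<in> V (partial_sum i s). i \<le> k}
      = Suc (card (returns (seq_shift i s) \<inter> {..n - i}))" if "i \<le> n" for i
  proof -
    have "k - i \<in> returns (seq_shift i s) \<inter> {..n - i} \<or> k = i" "i \<le> k" if "k \<in> V (partial_sum i s)" "i \<le> k" for k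
      using that \<open>i \<le> n\<close> by (auto simp: V_def mem_returns_seq_shift)
    moreover have "k = i + (k - i)" if "i \<le> k" for k using that by simp
    ultimately have "{k \<in> V (partial_sum i s). i \<le> k} \<subseteq> insert i ((+) i ` (returns (seq_shift i s) \<inter> {..n - i}))"
      by blast
    moreover have "insert i ((+) i ` (returns (seq_shift i s) \<inter> {..n - i})) \<subseteq> {k \<in> V (partial_sum i s). i \<le> k}"
      using that by (auto simp: V_def mem_returns_seq_shift)
    ultimately have "{k \<in> V (partial_sum i s). i \<le> k} = insert i ((+) i ` (returns (seq_shift i s) \<inter> {..n - i}))"
      by blast
    moreover have "i \<notin> (+) i ` (returns (seq_shift i s) \<inter> {..n - i})"
      by (auto simp: returns_def)
    ultimately show ?thesis
      by (simp add: card_image)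
  qed
  have "power_sum f n s = (\<Sum>x\<in>(\<lambda>i. partial_sum i s) ` {..n}. \<Sum>i\<in>V x.
      f (card {k \<in> V x. i \<le> k}) - f (card {k \<in> V x. i \<le> k} - 1))"
    unfolding power_sum_def
    by (intro sum.cong refl, subst sum_telescope_card_ge) (auto simp: V_def assms)
  also have "\<dots> = (\<Sum>x\<in>(\<lambda>i. partial_sum i s) ` {..n}. \<Sum>i | i \<in> {..n} \<and> partial_sum i s = x.
      f (Suc (card (returns (seq_shift i s) \<inter> {..n - i})))
        - f (card (returns (seq_shift i s) \<inter> {..n - i})))"
    using card_V by (intro sum.cong) (auto simp: V_def)
  also have "\<dots> = (\<Sum>i\<le>n. f (Suc (card (returns (seq_shift i s) \<inter> {..n - i})))
    - f (card (returns (seq_shift i s) \<inter> {..n - i})))"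
    \<comment> \<open>Each time belongs to exactly one visited site, so the double sum over sites
      and their visit times is a single sum over times.\<close>
    by (rule sum.group) auto
  finally show ?thesis .
qed

section \<open>Independence of past and future, and powers of the return probability\<close>

context sequence_space
begin

text \<open>Under the gluing map \<open>comb_seq m\<close> the first factor fixes the first
  \<open>m\<close> entries and the second is the shifted sequence. The preimage of the joint event
  is therefore the rectangle \<open>A \<times> B\<close>.\<close>

lemma prob_past_future:
  assumes A [measurable]: "A \<in> sets S" and B [measurable]: "B \<in> sets S"
    and past: "\<And>s s'. s \<in> space S \<Longrightarrow> s' \<in> space S \<Longrightarrow> (\<And>i. i < m \<Longrightarrow> s i = s' i) \<Longrightarrow> s \<in> A \<longleftrightarrow> s' \<in> A"
  shows "P.prob {s \<in> space S. s \<in> A \<and> seq_shift m s \<in> B} = P.prob A * P.prob B"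
proof -
  let ?E = "{s \<in> space S. s \<in> A \<and> seq_shift m s \<in> B}"
  let ?c = "\<lambda>(\<omega>, \<omega>'). comb_seq m \<omega> \<omega>'"
  have E: "?E \<in> sets S" by measurable
  have "comb_seq m s s' \<in> A \<longleftrightarrow> s \<in> A" if "s \<in> space S" "s' \<in> space S" for s s'
    using that measurable_space[OF measurable_comb_seq, of "(s, s')" M m]
    by (intro past) (auto simp: space_pair_measure comb_seq_def)
  moreover have "seq_shift m (comb_seq m s s') = s'" for s s' :: "nat \<Rightarrow> 'a"
    by (simp add: seq_shift_def comb_seq_def)
  moreover have "comb_seq m s s' \<in> space S" if "s \<in> space S" "s' \<in> space S" for s s'
    using that by (auto simp: space_PiM PiE_iff comb_seq_def)
  ultimately have "?c -` ?E \<inter> space (S \<Otimes>\<^sub>M S) = A \<times> B"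
    using sets.sets_into_space[OF A] sets.sets_into_space[OF B]
    by (auto simp: space_pair_measure subset_eq)
  then have "emeasure (distr (S \<Otimes>\<^sub>M S) S ?c) ?E = emeasure (S \<Otimes>\<^sub>M S) (A \<times> B)"
    using E by (subst emeasure_distr) auto
  then have "emeasure S ?E = emeasure (S \<Otimes>\<^sub>M S) (A \<times> B)"
    by (simp only: PiM_comb_seq)
  then show ?thesis
    by (simp add: P.emeasure_pair_measure_Times P.emeasure_eq_measure measure_nonneg
      flip: ennreal_mult)
qed

end

locale discrete_walk = sequence_space M for M :: "'b::{countable, ab_group_add} measure" +
  assumes sets_M: "sets M = sets (count_space UNIV)"
begin

lemma space_S [simp]: "space S = UNIV"
  using sets_eq_imp_space_eq[OF sets_M] by (auto simp: space_PiM)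

text \<open>Countability of the group allows conditioning on the value of the previous partial sum;
  adding a fixed value to a coordinate is measurable because every subset is.\<close>

lemma measurable_partial_sum [measurable]: "partial_sum n \<in> measurable S (count_space UNIV)"
proof (induction n)
  case (Suc n)
  have "measurable S M = measurable S (count_space UNIV)"
    by (rule measurable_cong_sets[OF refl sets_M])
  then have n: "(\<lambda>s. s n) \<in> measurable S (count_space UNIV)"
    using measurable_component_singleton[of n UNIV "\<lambda>_. M"] by simp
  have "(\<lambda>s. partial_sum n s + s n) \<in> measurable S (count_space UNIV)"
  proof (rule measurable_compose_countable[OF _ Suc])
    fix x
    show "(\<lambda>s. x + s n) \<in> measurable S (count_space UNIV)"
      by (rule measurable_compose[OF n]) simp
  qed
  then show ?case by (simp add: partial_sum_def[abs_def])
qed (simp add: partial_sum_def[abs_def])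

lemma pred_returns [measurable]: "Measurable.pred S (\<lambda>s. n \<in> returns s)"
  unfolding returns_def by simp

lemma pred_first_return [measurable]: "Measurable.pred S (first_return n)"
  unfolding first_return_def by measurable

lemma measurable_card_returns [measurable]:
  "(\<lambda>s. card (returns s)) \<in> measurable S (count_space UNIV)"
  "(\<lambda>s. card (returns s \<inter> {..n})) \<in> measurable S (count_space UNIV)"
  by measurable

lemma pred_infinite_returns [measurable]: "Measurable.pred S (\<lambda>s. infinite (returns s))"
  unfolding infinite_nat_iff_unbounded by measurable

lemma pred_returns_at_least [measurable]: "Measurable.pred S (returns_at_least k)"
  unfolding returns_at_least_def by measurable

text \<open>Markov property at the first return: split by its time \<open>m\<close>, factor each
  piece into past and future, and sum. The future factor does not depend on
  \<open>m\<close>.\<close>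

lemma prob_returns_at_least_Suc:
  "P.prob {s. returns_at_least (Suc k) s}
    = P.prob {s. returns_at_least 1 s} * P.prob {s. returns_at_least k s}"
proof -
  have "(\<lambda>m. P.prob {s. first_return m s} * P.prob {s. returns_at_least k s}) sums
    P.prob {s. returns_at_least (Suc k) s}" for k
  proof -
    let ?E = "\<lambda>m. {s. first_return m s \<and> returns_at_least k (seq_shift m s)}"
    have [measurable]: "?E m \<in> sets S" "{s. first_return m s} \<in> sets S" "{s. returns_at_least k s} \<in> sets S" for m
    proof -
      have "{s\<in>space S. first_return m s \<and> returns_at_least k (seq_shift m s)} \<in> sets S"
        "{s\<in>space S. first_return m s} \<in> sets S" "{s\<in>space S. returns_at_least k s} \<in> sets S"
        by measurable
      then show "?E m \<in> sets S" "{s. first_return m s} \<in> sets S" "{s. returns_at_least k s} \<in> sets S"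
        by simp_all
    qed
    have sums: "(\<lambda>m. P.prob (?E m)) sums P.prob (\<Union>m. ?E m)"
      by (intro P.finite_measure_UNION)
        (auto simp: disjoint_family_on_def dest: first_return_unique)
    have UN: "(\<Union>m. ?E m) = {s. returns_at_least (Suc k) s}"
      by (auto simp: returns_at_least_Suc)
    have "P.prob (?E m) = P.prob {s. first_return m s} * P.prob {s. returns_at_least k s}" for m
    proof -
      have "P.prob {s \<in> space S. s \<in> {s. first_return m s} \<and> seq_shift m s \<in> {s. returns_at_least k s}}
          = P.prob {s. first_return m s} * P.prob {s. returns_at_least k s}"
      proof (rule prob_past_future)
        show "s \<in> {s. first_return m s} \<longleftrightarrow> s' \<in> {s. first_return m s}"
          if "\<And>i. i < m \<Longrightarrow> s i = s' i" for s s'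
          using first_return_past[OF that] by simp
      qed simp_all
      then show ?thesis by simp
    qed
    with sums show ?thesis unfolding UN by simp
  qed
  note sums = this
  \<comment> \<open>The case \<open>k = 0\<close> of the series identifies the total mass of the
    first return times as the probability of at least one return.\<close>
  have "P.prob {s. returns_at_least 0 s} = 1"
    using P.prob_space by (simp add: returns_at_least_def)
  then have "(\<lambda>m. P.prob {s. first_return m s}) sums P.prob {s. returns_at_least 1 s}"
    using sums[of 0] by simp
  then have "(\<lambda>m. P.prob {s. first_return m s} * P.prob {s. returns_at_least k s}) sums
      (P.prob {s. returns_at_least 1 s} * P.prob {s. returns_at_least k s})"
    by (rule sums_mult2)
  with sums[of k] show ?thesis
    by (rule sums_unique2)
qed

lemma prob_returns_at_least:
  "P.prob {s. returns_at_least k s} = P.prob {s. returns_at_least 1 s} ^ k"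
proof (induction k)
  case 0
  show ?case using P.prob_space by (simp add: returns_at_least_def)
next
  case (Suc k)
  then show ?case by (subst prob_returns_at_least_Suc) simp
qed

end

section \<open>The geometric law of the number of returns\<close>

locale transient_discrete_walk = discrete_walk +
  fixes \<gamma> :: real
  assumes \<gamma>_def: "\<gamma> = P.prob {s. returns s = {}}"
    and gamma_pos: "0 < \<gamma>"
begin

lemma prob_return: "P.prob {s. returns_at_least 1 s} = 1 - \<gamma>"
proof -
  have "{s\<in>space S. \<forall>n. n \<notin> returns s} \<in> sets S" by measurable
  moreover have "{s\<in>space S. \<forall>n. n \<notin> returns s} = {s. returns s = {}}" by auto
  ultimately have "{s. returns s = {}} \<in> sets S" by simp
  then have "P.prob (space S - {s. returns s = {}}) = 1 - \<gamma>"
    unfolding \<gamma>_def by (rule P.prob_compl)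
  moreover have "space S - {s. returns s = {}} = {s. returns_at_least 1 s}"
    by (auto simp: returns_at_least_def Suc_le_eq card_gt_0_iff)
  ultimately show ?thesis by simp
qed

lemma gamma_le_1: "\<gamma> \<le> 1"
  unfolding \<gamma>_def by simp

text \<open>Infinitely many returns imply at least \<open>k\<close> returns for each
  \<open>k\<close>, an event of probability \<open>(1 - \<gamma>) ^ k\<close>, which tends to
  0.\<close>

lemma AE_finite_returns: "AE s in S. finite (returns s)"
proof -
  let ?E = "{s. infinite (returns s)}"
  have "{s\<in>space S. infinite (returns s)} \<in> sets S" by measurable
  then have E: "?E \<in> sets S" by simp
  have le: "P.prob ?E \<le> (1 - \<gamma>) ^ k" for k
  proof -
    have "{s\<in>space S. returns_at_least k s} \<in> sets S" by measurable
    then have "P.prob ?E \<le> P.prob {s. returns_at_least k s}"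
      by (intro P.finite_measure_mono) (auto simp: returns_at_least_def)
    then show ?thesis unfolding prob_returns_at_least[of k] prob_return .
  qed
  have "(\<lambda>k. (1 - \<gamma>) ^ k) \<longlonglongrightarrow> 0"
    using gamma_pos gamma_le_1 by (intro LIMSEQ_power_zero) auto
  then have "P.prob ?E \<le> 0"
    using le by (intro LIMSEQ_le_const) auto
  then have "P.prob ?E = 0"
    using measure_nonneg[of S ?E] by linarith
  then have "AE s in S. s \<notin> ?E"
    using E by (simp add: P.prob_eq_0)
  then show ?thesis by simp
qed

text \<open>Exactly \<open>k\<close> returns means at least \<open>k\<close> but not at least
  \<open>k + 1\<close>. This holds only almost surely, since \<open>card\<close> sends an infinite
  set of returns to 0. The difference of the two powers is the geometric weight on 0, 1, 2,
  ...\<close>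

lemma distr_card_returns:
  "distr S (count_space UNIV) (\<lambda>s. card (returns s)) = measure_pmf (geometric_pmf \<gamma>)"
proof (rule measure_eqI_countable[of _ UNIV])
  fix k :: nat
  have [measurable]: "{s. returns_at_least j s} \<in> sets S" for j
  proof -
    have "{s\<in>space S. returns_at_least j s} \<in> sets S" by measurable
    then show ?thesis by simp
  qed
  have [measurable]: "{s. card (returns s) = k} \<in> sets S"
  proof -
    have "{s\<in>space S. card (returns s) = k} \<in> sets S" by measurable
    then show ?thesis by simp
  qed
  have "P.prob {s. card (returns s) = k}
      = P.prob ({s. returns_at_least k s} - {s. returns_at_least (Suc k) s})"
  proof (rule P.finite_measure_eq_AE)
    show "AE s in S. (s \<in> {s. card (returns s) = k})
      = (s \<in> {s. returns_at_least k s} - {s. returns_at_least (Suc k) s})"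
      using AE_finite_returns by eventually_elim (auto simp: returns_at_least_def)
  qed auto
  also have "\<dots> = (1 - \<gamma>) ^ k - (1 - \<gamma>) ^ Suc k"
    unfolding prob_returns_at_least[of k, unfolded prob_return, symmetric]
      prob_returns_at_least[of "Suc k", unfolded prob_return, symmetric]
    by (rule P.finite_measure_Diff) (simp, simp, auto simp: returns_at_least_def)
  also have "\<dots> = pmf (geometric_pmf \<gamma>) k"
    using gamma_pos gamma_le_1 by (simp add: algebra_simps)
  finally show "emeasure (distr S (count_space UNIV) (\<lambda>s. card (returns s))) {k}
      = emeasure (measure_pmf (geometric_pmf \<gamma>)) {k}"
    by (simp add: emeasure_distr emeasure_pmf_single P.emeasure_eq_measure vimage_def)
qed auto

lemma
  fixes h :: "nat \<Rightarrow> real"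
  assumes "summable (\<lambda>k. \<bar>h k\<bar> * (1 - \<gamma>) ^ k)"
  shows integrable_card_returns: "integrable S (\<lambda>s. h (card (returns s)))"
    and integral_card_returns: "(\<integral>s. h (card (returns s)) \<partial>S) = \<gamma> * (\<Sum>k. h k * (1 - \<gamma>) ^ k)"
proof -
  have pmf_eq: "pmf (geometric_pmf \<gamma>) k * h k = \<gamma> * (h k * (1 - \<gamma>) ^ k)" for k
    using gamma_pos gamma_le_1 by simp
  have sum: "summable (\<lambda>k. norm (pmf (geometric_pmf \<gamma>) k * h k))"
    using summable_mult[OF assms, of \<gamma>] gamma_pos gamma_le_1
    unfolding pmf_eq by (simp add: abs_mult power_abs)
  then have int: "integrable (count_space UNIV) (\<lambda>k. pmf (geometric_pmf \<gamma>) k * h k)"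
    by (simp add: integrable_count_space_nat_iff)
  then have int_h: "integrable (measure_pmf (geometric_pmf \<gamma>)) h"
    unfolding measure_pmf_eq_density by (simp add: integrable_density)
  have h: "h \<in> borel_measurable (count_space UNIV)" by simp
  show "integrable S (\<lambda>s. h (card (returns s)))"
    using integrable_distr_eq[OF measurable_card_returns(1) h] int_h unfolding distr_card_returns
    by blast
  have "(\<integral>s. h (card (returns s)) \<partial>S) = measure_pmf.expectation (geometric_pmf \<gamma>) h"
    using integral_distr[OF measurable_card_returns(1) h] unfolding distr_card_returns by (rule sym)
  also have "\<dots> = (\<integral>k. pmf (geometric_pmf \<gamma>) k * h k \<partial>count_space UNIV)"
    unfolding measure_pmf_eq_density by (simp add: integral_density)
  also have "\<dots> = (\<Sum>k. \<gamma> * (h k * (1 - \<gamma>) ^ k))"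
    unfolding pmf_eq by (rule integral_count_space_nat[OF int[unfolded pmf_eq]])
  finally have *: "(\<integral>s. h (card (returns s)) \<partial>S) = (\<Sum>k. \<gamma> * (h k * (1 - \<gamma>) ^ k))" .
  have "summable (\<lambda>k. h k * (1 - \<gamma>) ^ k)"
  proof (rule summable_rabs_cancel)
    show "summable (\<lambda>k. \<bar>h k * (1 - \<gamma>) ^ k\<bar>)"
      using assms gamma_le_1 by (simp add: abs_mult)
  qed
  then have "(\<Sum>k. \<gamma> * (h k * (1 - \<gamma>) ^ k)) = \<gamma> * (\<Sum>k. h k * (1 - \<gamma>) ^ k)"
    by (rule suminf_mult)
  with * show "(\<integral>s. h (card (returns s)) \<partial>S) = \<gamma> * (\<Sum>k. h k * (1 - \<gamma>) ^ k)"
    by (rule trans)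
qed

end

section \<open>Convergence\<close>

text \<open>Normalises by \<open>n\<close> the Birkhoff sums of \<open>Suc n - m\<close> terms,
  because the ratio of the two lengths tends to 1. With \<open>m = 0\<close> it covers the full sum
  over times 0 to \<open>n\<close>.\<close>

lemma LIMSEQ_div_n_shift:
  fixes a :: "nat \<Rightarrow> real"
  assumes "(\<lambda>n. a n / n) \<longlonglongrightarrow> c"
  shows "(\<lambda>n. a (Suc n - m) / n) \<longlonglongrightarrow> c"
proof -
  have "filterlim (\<lambda>n. Suc n - m) sequentially sequentially"
    unfolding filterlim_at_top
  proof
    fix Z
    show "\<forall>\<^sub>F n in sequentially. Z \<le> Suc n - m"
      using eventually_ge_at_top[of "Z + m"] by eventually_elim simp
  qed
  with assms have "(\<lambda>n. a (Suc n - m) / real (Suc n - m)) \<longlonglongrightarrow> c"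
    by (rule filterlim_compose[of "\<lambda>n. a n / real n"])
  moreover have "(\<lambda>n. real (Suc n - m) / n) \<longlonglongrightarrow> 1"
  proof (rule Lim_transform_eventually)
    show "(\<lambda>n. 1 + (1 - real m) / n) \<longlonglongrightarrow> 1"
      using tendsto_add[OF tendsto_const lim_const_over_n[of "1 - real m"], of 1] by simp
    show "\<forall>\<^sub>F n in sequentially. 1 + (1 - real m) / n = real (Suc n - m) / n"
      using eventually_ge_at_top[of "Suc m"]
      by eventually_elim (simp add: field_simps of_nat_diff)
  qed
  ultimately have "(\<lambda>n. a (Suc n - m) / real (Suc n - m) * (real (Suc n - m) / n)) \<longlonglongrightarrow> c * 1"
    by (rule tendsto_mult)
  then have "(\<lambda>n. a (Suc n - m) / real (Suc n - m) * (real (Suc n - m) / n)) \<longlonglongrightarrow> c"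
    by (simp only: mult_1_right)
  then show ?thesis
  proof (rule Lim_transform_eventually)
    show "\<forall>\<^sub>F n in sequentially.
      a (Suc n - m) / real (Suc n - m) * (real (Suc n - m) / n) = a (Suc n - m) / n"
      using eventually_ge_at_top[of "Suc m"] by eventually_elim simp
  qed
qed

text \<open>Cauchy-Schwarz against the constant 1, used once for the terms and once for their
  squares.\<close>

lemma power4_sum_le:
  fixes a :: "'i \<Rightarrow> real"
  shows "(\<Sum>i\<in>A. a i) ^ 4 \<le> real (card A) ^ 3 * (\<Sum>i\<in>A. a i ^ 4)"
proof -
  have "((\<Sum>i\<in>A. a i)\<^sup>2)\<^sup>2 \<le> (card A * (\<Sum>i\<in>A. (a i)\<^sup>2))\<^sup>2"
    using sum_squared_le_sum_of_squares[of a A] by (intro power_mono) (simp_all add: mult.commute)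
  also have "\<dots> = real (card A) ^ 2 * (\<Sum>i\<in>A. (a i)\<^sup>2)\<^sup>2"
    by (rule power_mult_distrib)
  also have "\<dots> \<le> real (card A) ^ 2 * (card A * (\<Sum>i\<in>A. ((a i)\<^sup>2)\<^sup>2))"
    using sum_squared_le_sum_of_squares[of "\<lambda>i. (a i)\<^sup>2" A]
    by (intro mult_left_mono) (simp_all add: mult.commute)
  finally show ?thesis
    by (simp add: power2_eq_square power3_eq_cube power4_eq_xxxx mult.assoc)
qed

text \<open>Bounded fourth moments make the squares uniformly integrable, so that almost sure
  convergence implies convergence in mean square.\<close>

lemma (in prob_space) AE_tendsto_imp_L2:
  fixes Y :: "nat \<Rightarrow> 'a \<Rightarrow> real"
  assumes [measurable]: "\<And>n. Y n \<in> borel_measurable M"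
    and int: "\<And>n. integrable M (\<lambda>\<omega>. Y n \<omega> ^ 4)"
    and bound: "\<And>n. (\<integral>\<omega>. Y n \<omega> ^ 4 \<partial>M) \<le> B"
    and lim: "AE \<omega> in M. (\<lambda>n. Y n \<omega>) \<longlonglongrightarrow> c"
  shows "tendsto_L2 M Y (\<lambda>_. c)"
proof -
  have square_le: "x\<^sup>2 \<le> 1 + x ^ 4" for x :: real
  proof -
    have "0 \<le> (x\<^sup>2 - 1)\<^sup>2 + x\<^sup>2" by simp
    also have "\<dots> = 1 + x ^ 4 - x\<^sup>2"
      by (simp add: power2_eq_square power4_eq_xxxx algebra_simps)
    finally show ?thesis by simp
  qed
  have int2: "integrable M (\<lambda>\<omega>. (Y n \<omega>)\<^sup>2)" for n
    by (rule Bochner_Integration.integrable_bound[of _ "\<lambda>\<omega>. 1 + Y n \<omega> ^ 4"])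
      (use int square_le in \<open>auto intro!: AE_I2 order_trans[OF square_le]\<close>)
  \<comment> \<open>The constant is the cube of the number 2 of summands \<open>x\<close> and
    \<open>- c\<close>.\<close>
  have four: "(x - c) ^ 4 \<le> 8 * (x ^ 4 + c ^ 4)" for x :: real
    using power4_sum_le[of "\<lambda>b. if b then x else - c" "UNIV :: bool set"] by (simp add: UNIV_bool)
  have int4: "integrable M (\<lambda>\<omega>. (Y n \<omega> - c) ^ 4)" for n
    by (rule Bochner_Integration.integrable_bound[of _ "\<lambda>\<omega>. 8 * (Y n \<omega> ^ 4 + c ^ 4)"])
      (use int four in \<open>auto intro!: AE_I2 order_trans[OF four]\<close>)
  have int4_le: "(\<integral>\<omega>. (Y n \<omega> - c) ^ 4 \<partial>M) \<le> 8 * (B + c ^ 4)" for n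
  proof -
    have "(\<integral>\<omega>. (Y n \<omega> - c) ^ 4 \<partial>M) \<le> (\<integral>\<omega>. 8 * (Y n \<omega> ^ 4 + c ^ 4) \<partial>M)"
      using int int4 four by (intro integral_mono) auto
    also have "\<dots> \<le> 8 * (B + c ^ 4)"
      using int bound by (simp add: prob_space)
    finally show ?thesis .
  qed
  have nonneg: "0 \<le> 8 * (B + c ^ 4)"
    using order_trans[OF integral_nonneg_AE int4_le[of 0]] by simp
  have "(\<lambda>n. \<integral>\<omega>. (Y n \<omega> - c)\<^sup>2 \<partial>M) \<longlonglongrightarrow> 0"
  proof (rule order_tendstoI)
    fix e :: real assume "0 < e"
    \<comment> \<open>Truncation level for the squared deviations, large enough that the tail beyond
      it contributes less than \<open>e\<close>. The added 1 keeps it positive when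
      \<open>B + c ^ 4\<close> is 0.\<close>
    define K where "K = 16 * (B + c ^ 4) / e + 1"
    have K: "K > 0" "8 * (B + c ^ 4) / K < e"
    proof -
      have "0 \<le> 16 * (B + c ^ 4) / e"
        using nonneg \<open>0 < e\<close> by simp
      then show "K > 0" by (simp add: K_def)
      have "e * K = 16 * (B + c ^ 4) + e"
        using \<open>0 < e\<close> by (simp add: K_def field_simps)
      then have "8 * (B + c ^ 4) < e * K"
        using nonneg \<open>0 < e\<close> by linarith
      then show "8 * (B + c ^ 4) / K < e"
        using \<open>K > 0\<close> by (simp only: pos_divide_less_eq)
    qed
    have "(\<lambda>n. \<integral>\<omega>. min ((Y n \<omega> - c)\<^sup>2) K \<partial>M) \<longlonglongrightarrow> (\<integral>\<omega>. 0 \<partial>M)"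
    proof (rule integral_dominated_convergence[where w="\<lambda>_. K"])
      show "AE \<omega> in M. (\<lambda>n. min ((Y n \<omega> - c)\<^sup>2) K) \<longlonglongrightarrow> 0"
        using lim
      proof eventually_elim
        case (elim \<omega>)
        have "(\<lambda>n. min ((Y n \<omega> - c)\<^sup>2) K) \<longlonglongrightarrow> min ((c - c)\<^sup>2) K"
          by (intro tendsto_intros elim)
        then show ?case using K by simp
      qed
    qed (use K in auto)
    then have "\<forall>\<^sub>F n in sequentially. (\<integral>\<omega>. min ((Y n \<omega> - c)\<^sup>2) K \<partial>M) < e - 8 * (B + c ^ 4) / K"
      using K by (intro order_tendstoD(2)) auto
    then show "\<forall>\<^sub>F n in sequentially. (\<integral>\<omega>. (Y n \<omega> - c)\<^sup>2 \<partial>M) < e"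
    proof eventually_elim
      case (elim n)
      \<comment> \<open>Above the level \<open>K\<close> one has
        \<open>x \<le> x\<^sup>2 / K\<close>. With \<open>x\<close> the squared deviation, the
        excess over the truncation is thus paid for by the fourth moment.\<close>
      have "x \<le> min x K + x\<^sup>2 / K" if "0 \<le> x" for x :: real
      proof (cases "x \<le> K")
        case False
        then have "x * K \<le> x\<^sup>2"
          using that by (simp add: power2_eq_square mult_left_mono)
        then have "x \<le> x\<^sup>2 / K" using K by (simp add: pos_le_divide_eq)
        then show ?thesis using K that False by simp
      qed (use K in simp)
      from this[OF zero_le_power2]
      have split: "(x - c)\<^sup>2 \<le> min ((x - c)\<^sup>2) K + (x - c) ^ 4 / K" for x
        by (simp flip: power_mult)
      have int_min: "integrable M (\<lambda>\<omega>. min ((Y n \<omega> - c)\<^sup>2) K)"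
        using K by (intro integrable_const_bound[where B=K]) auto
      have "(\<integral>\<omega>. (Y n \<omega> - c)\<^sup>2 \<partial>M) \<le> (\<integral>\<omega>. min ((Y n \<omega> - c)\<^sup>2) K + (Y n \<omega> - c) ^ 4 / K \<partial>M)"
        using int_min int4[of n]
        by (intro integral_mono_AE' AE_I2 split order_trans[OF zero_le_power2 split]) auto
      also have "\<dots> = (\<integral>\<omega>. min ((Y n \<omega> - c)\<^sup>2) K \<partial>M) + (\<integral>\<omega>. (Y n \<omega> - c) ^ 4 \<partial>M) / K"
        using int_min int4[of n] by simp
      also have "(\<integral>\<omega>. (Y n \<omega> - c) ^ 4 \<partial>M) / K \<le> 8 * (B + c ^ 4) / K"
        using int4_le[of n] K by (intro divide_right_mono) auto
      finally show ?case using elim by simp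
    qed
  next
    fix e :: real assume "e < 0"
    have "0 \<le> (\<integral>\<omega>. (Y n \<omega> - c)\<^sup>2 \<partial>M)" for n
      by (intro integral_nonneg_AE) simp
    with \<open>e < 0\<close> show "\<forall>\<^sub>F n in sequentially. e < (\<integral>\<omega>. (Y n \<omega> - c)\<^sup>2 \<partial>M)"
      by (auto intro!: always_eventually elim: less_le_trans)
  qed
  then show ?thesis
    unfolding tendsto_L2_def using int2 by simp
qed

section \<open>Comparison of the power sum with Birkhoff sums\<close>

context transient_discrete_walk
begin

text \<open>The upper bound drops the subtracted term of each increment and counts all later returns
  instead of those up to time \<open>n\<close>. Finiteness is needed for the second step, as an
  infinite set would have \<open>card\<close> 0.\<close>

lemma
  assumes f: "mono f" "f 0 = 0"
  shows power_sum_nonneg: "0 \<le> power_sum f n s"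
    and power_sum_le: "(\<And>i. finite (returns (seq_shift i s))) \<Longrightarrow>
      power_sum f n s \<le> birkhoff_sum (\<lambda>s. f (Suc (card (returns s)))) (Suc n) s"
proof -
  have f_mono: "f i \<le> f j" if "i \<le> j" for i j
    using f(1) that by (rule monoD)
  have f_nonneg: "0 \<le> f i" for i
    using f_mono[of 0 i] f(2) by simp
  show "0 \<le> power_sum f n s"
    unfolding power_sum_def by (intro sum_nonneg f_nonneg)
  assume fin: "finite (returns (seq_shift i s))" for i
  show "power_sum f n s \<le> birkhoff_sum (\<lambda>s. f (Suc (card (returns s)))) (Suc n) s"
    unfolding power_sum_eq_increments[where f=f, OF f(2)] birkhoff_sum_def lessThan_Suc_atMost
  proof (rule sum_mono)
    fix i
    have "card (returns (seq_shift i s) \<inter> {..n - i}) \<le> card (returns (seq_shift i s))"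
      using fin by (intro card_mono) auto
    then show "f (Suc (card (returns (seq_shift i s) \<inter> {..n - i})))
        - f (card (returns (seq_shift i s) \<inter> {..n - i})) \<le> f (Suc (card (returns (seq_shift i s))))"
      using f_mono[of "Suc (card (returns (seq_shift i s) \<inter> {..n - i}))" "Suc (card (returns (seq_shift i s)))"]
        f_nonneg[of "card (returns (seq_shift i s) \<inter> {..n - i})"] by simp
  qed
qed

lemma power_sum_measurable [measurable]:
  assumes "f 0 = 0"
  shows "power_sum f n \<in> borel_measurable S"
proof -
  have "(\<lambda>s. f (Suc (card (returns (seq_shift i s) \<inter> {..n - i})))
      - f (card (returns (seq_shift i s) \<inter> {..n - i}))) \<in> borel_measurable S" for i
    by (rule measurable_compose[OF measurable_compose[OF measurable_seq_shift measurable_card_returns(2)]])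
      simp
  then show ?thesis
    by (subst measurable_cong[OF power_sum_eq_increments[where f=f, OF assms]])
      (intro borel_measurable_sum)
qed

text \<open>\<open>G\<close> is the increment for the total number of returns, and \<open>D\<close>
  is \<open>F\<close> restricted to walks that return after time \<open>m\<close>. If
  \<open>i + m \<le> n\<close> and no return comes later than \<open>m\<close>, the truncated count
  is already the total and the summand is exact; any other summand errs by at most \<open>F\<close>.
  The last \<open>m\<close> times make up the difference of the two sums of
  \<open>F\<close>.\<close>

lemma power_sum_tail_estimate:
  fixes f :: "nat \<Rightarrow> real" and m n :: nat
  assumes f: "mono f" "f 0 = 0" and fin: "\<And>i. finite (returns (seq_shift i s))"
  defines "F \<equiv> \<lambda>s :: nat \<Rightarrow> 'a. f (Suc (card (returns s)))"
    and "G \<equiv> \<lambda>s :: nat \<Rightarrow> 'a. f (Suc (card (returns s))) - f (card (returns s))"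
    and "D \<equiv> \<lambda>s :: nat \<Rightarrow> 'a. if card (returns s \<inter> {..m}) = card (returns s) then 0
      else f (Suc (card (returns s)))"
  shows "\<bar>power_sum f n s - birkhoff_sum G (Suc n) s\<bar>
    \<le> birkhoff_sum D (Suc n) s + (birkhoff_sum F (Suc n) s - birkhoff_sum F (Suc n - m) s)"
proof -
  have f_mono: "f i \<le> f j" if "i \<le> j" for i j
    using f(1) that by (rule monoD)
  have f_nonneg: "0 \<le> f i" for i
    using f_mono[of 0 i] f(2) by simp
  let ?c = "\<lambda>i. card (returns (seq_shift i s) \<inter> {..n - i})"
  have term_le: "\<bar>f (Suc (?c i)) - f (?c i) - G (seq_shift i s)\<bar>
      \<le> D (seq_shift i s) + (if i < Suc n - m then 0 else F (seq_shift i s))" for i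
  proof -
    let ?R = "returns (seq_shift i s)"
    have c_le: "?c i \<le> card ?R"
      using fin by (intro card_mono) auto
    \<comment> \<open>Both increments lie between 0 and \<open>F\<close>, hence so does their
      distance.\<close>
    have "\<bar>f (Suc (?c i)) - f (?c i) - G (seq_shift i s)\<bar> \<le> F (seq_shift i s)"
      unfolding G_def F_def
      using f_mono[of "Suc (?c i)" "Suc (card ?R)"] f_mono[of "?c i" "Suc (?c i)"]
        f_mono[of "card ?R" "Suc (card ?R)"] f_nonneg[of "?c i"] f_nonneg[of "card ?R"] c_le by simp
    moreover have "f (Suc (?c i)) - f (?c i) = G (seq_shift i s)"
      if "i < Suc n - m" "card (?R \<inter> {..m}) = card ?R"
    proof -
      have "card (?R \<inter> {..m}) \<le> ?c i"
        using that by (intro card_mono) auto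
      then show ?thesis using c_le that by (simp add: G_def)
    qed
    moreover have "0 \<le> D (seq_shift i s)"
      by (simp add: D_def f_nonneg)
    ultimately show ?thesis
      by (auto simp: D_def F_def)
  qed
  have "\<bar>power_sum f n s - birkhoff_sum G (Suc n) s\<bar>
      = \<bar>\<Sum>i<Suc n. f (Suc (?c i)) - f (?c i) - G (seq_shift i s)\<bar>"
    unfolding power_sum_eq_increments[where f=f, OF f(2)] birkhoff_sum_def lessThan_Suc_atMost
    by (simp only: sum_subtractf)
  also have "\<dots> \<le> (\<Sum>i<Suc n. D (seq_shift i s) + (if i < Suc n - m then 0 else F (seq_shift i s)))"
    by (rule order_trans[OF sum_abs sum_mono[OF term_le]])
  also have "\<dots> = birkhoff_sum D (Suc n) s
      + (\<Sum>i<Suc n. F (seq_shift i s) - (if i < Suc n - m then F (seq_shift i s) else 0))"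
    unfolding birkhoff_sum_def sum.distrib by (intro arg_cong2[where f="(+)"] sum.cong) auto
  also have "(\<Sum>i<Suc n. if i < Suc n - m then F (seq_shift i s) else 0) = birkhoff_sum F (Suc n - m) s"
    unfolding birkhoff_sum_def by (rule sum.mono_neutral_cong_right) auto
  then have "(\<Sum>i<Suc n. F (seq_shift i s) - (if i < Suc n - m then F (seq_shift i s) else 0))
      = birkhoff_sum F (Suc n) s - birkhoff_sum F (Suc n - m) s"
    unfolding sum_subtractf by (simp add: birkhoff_sum_def)
  finally show ?thesis .
qed

lemma AE_finite_returns_seq_shift: "AE s in S. \<forall>i. finite (returns (seq_shift i s))"
  unfolding AE_all_countable using AE_shift[OF AE_finite_returns] by blast

theorem AE_power_sum_tendsto:
  assumes f: "mono f" "f 0 = 0" and sum: "summable (\<lambda>k. f (Suc k) * (1 - \<gamma>) ^ k)"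
  shows "AE s in S. (\<lambda>n. power_sum f n s / n) \<longlonglongrightarrow> \<gamma>\<^sup>2 * (\<Sum>k. f (Suc k) * (1 - \<gamma>) ^ k)"
proof -
  have f_mono: "f i \<le> f j" if "i \<le> j" for i j
    using f(1) that by (rule monoD)
  have f_nonneg: "0 \<le> f i" for i
    using f_mono[of 0 i] f(2) by simp
  note gamma_le_1 [simp]
  define F where "F = (\<lambda>s :: nat \<Rightarrow> 'a. f (Suc (card (returns s))))"
  define G where "G = (\<lambda>s :: nat \<Rightarrow> 'a. f (Suc (card (returns s))) - f (card (returns s)))"
  define D where "D m = (\<lambda>s. if card (returns s \<inter> {..m}) = card (returns s) then 0 else F s)" for m
  let ?A = "\<Sum>k. f (Suc k) * (1 - \<gamma>) ^ k"
  have sum_f: "summable (\<lambda>k. f k * (1 - \<gamma>) ^ k)"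
    by (rule summable_comparison_test'[OF sum])
      (auto simp: abs_mult f_nonneg intro!: mult_right_mono f_mono)
  have F: "integrable S F"
    unfolding F_def by (rule integrable_card_returns) (simp add: f_nonneg sum)
  have sum_G: "summable (\<lambda>k. (f (Suc k) - f k) * (1 - \<gamma>) ^ k)"
    using summable_diff[OF sum sum_f] by (simp add: left_diff_distrib)
  have "summable (\<lambda>k. \<bar>f (Suc k) - f k\<bar> * (1 - \<gamma>) ^ k)"
    using sum_G f_mono[OF le_SucI[OF order_refl]] by simp
  note G = integrable_card_returns[OF this, folded G_def] integral_card_returns[OF this, folded G_def]
  \<comment> \<open>Summation by parts: as \<open>f 0 = 0\<close>, the series of \<open>f k\<close>
    is \<open>1 - \<gamma>\<close> times the series of \<open>f (Suc k)\<close>, so the increments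
    sum to \<open>\<gamma> * ?A\<close>. The second factor \<open>\<gamma>\<close> comes from the
    geometric weights.\<close>
  have int_G: "(\<integral>s. G s \<partial>S) = \<gamma>\<^sup>2 * ?A"
  proof -
    have "(\<Sum>k. f k * (1 - \<gamma>) ^ k) = (\<Sum>k. (1 - \<gamma>) * (f (Suc k) * (1 - \<gamma>) ^ k))"
      using suminf_split_head[OF sum_f] f(2) by (simp add: mult_ac)
    also have "\<dots> = (1 - \<gamma>) * ?A"
      by (rule suminf_mult[OF sum])
    finally have "(\<Sum>k. (f (Suc k) - f k) * (1 - \<gamma>) ^ k) = ?A - (1 - \<gamma>) * ?A"
      using suminf_diff[OF sum sum_f] by (simp add: left_diff_distrib)
    then show ?thesis
      unfolding G(2) by (simp add: power2_eq_square algebra_simps)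
  qed
  have D_measurable [measurable]: "D m \<in> borel_measurable S" for m
  proof -
    have "F \<in> borel_measurable S" using F by auto
    \<comment> \<open>Equality of the two counts is written as a countable disjunction over their
      common value to obtain measurability.\<close>
    then have "(\<lambda>s. if \<exists>k. card (returns s \<inter> {..m}) = k \<and> card (returns s) = k then 0 else F s)
        \<in> borel_measurable S"
      by measurable
    then show ?thesis
      unfolding D_def by (simp add: eq_commute)
  qed
  have D: "integrable S (D m)" for m
    by (rule Bochner_Integration.integrable_bound[OF F D_measurable]) (auto simp: D_def F_def)
  \<comment> \<open>Almost every walk has a last return, after which \<open>D m\<close> vanishes;
    \<open>F\<close> dominates.\<close>
  have "(\<lambda>m. \<integral>s. D m s \<partial>S) \<longlonglongrightarrow> (\<integral>s. 0 \<partial>S)"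
  proof (rule integral_dominated_convergence[where w=F])
    show "AE s in S. (\<lambda>m. D m s) \<longlonglongrightarrow> 0"
      using AE_finite_returns
    proof eventually_elim
      case (elim s)
      then obtain N where "returns s \<subseteq> {..N}"
        using finite_nat_iff_bounded_le by blast
      then have "D m s = 0" if "N \<le> m" for m
        using that by (auto simp: D_def intro!: arg_cong[where f=card])
      then show ?case
        by (intro tendsto_eventually eventually_sequentiallyI[of N])
    qed
  qed (use F D_measurable in \<open>auto simp: D_def F_def f_nonneg\<close>)
  then have D_lim: "(\<lambda>m. \<integral>s. D m s \<partial>S) \<longlonglongrightarrow> 0" by simp
  have "AE s in S. \<forall>m. (\<lambda>n. birkhoff_sum (D m) n s / n) \<longlonglongrightarrow> (\<integral>s. D m s \<partial>S)"
    unfolding AE_all_countable using birkhoff[OF D] by blast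
  with birkhoff[OF F] birkhoff[OF G(1)] AE_finite_returns_seq_shift show ?thesis
  proof eventually_elim
    case (elim s)
    have "(\<lambda>n. power_sum f n s / n - \<gamma>\<^sup>2 * ?A) \<longlonglongrightarrow> 0"
    proof (rule tendstoI)
      fix e :: real assume "0 < e"
      then have "\<forall>\<^sub>F m in sequentially. (\<integral>s. D m s \<partial>S) < e / 2"
        using D_lim by (intro order_tendstoD(2)) auto
      then obtain m where m: "(\<integral>s. D m s \<partial>S) < e / 2"
        by (auto simp: eventually_sequentially)
      \<comment> \<open>The two averages of \<open>F\<close> have the same limit and cancel, leaving
        the mean of \<open>D m\<close>, which is below \<open>e / 2\<close>. Writing
        \<open>Suc n - 0\<close> brings every sum into the form of
        \<open>LIMSEQ_div_n_shift\<close>.\<close>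
      let ?R = "\<lambda>n. birkhoff_sum (D m) (Suc n - 0) s / n + (birkhoff_sum F (Suc n - 0) s / n
        - birkhoff_sum F (Suc n - m) s / n)"
      have "?R \<longlonglongrightarrow> (\<integral>s. D m s \<partial>S) + ((\<integral>s. F s \<partial>S) - (\<integral>s. F s \<partial>S))"
        using elim by (intro tendsto_intros LIMSEQ_div_n_shift) auto
      then have R: "\<forall>\<^sub>F n in sequentially. ?R n < e / 2"
        using m by (intro order_tendstoD(2)) auto
      have "(\<lambda>n. birkhoff_sum G (Suc n - 0) s / n) \<longlonglongrightarrow> \<gamma>\<^sup>2 * ?A"
        using elim(2) unfolding int_G by (rule LIMSEQ_div_n_shift)
      then have "\<forall>\<^sub>F n in sequentially. dist (birkhoff_sum G (Suc n - 0) s / n) (\<gamma>\<^sup>2 * ?A) < e / 2"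
        using \<open>0 < e\<close> by (intro tendstoD) auto
      then show "\<forall>\<^sub>F n in sequentially. dist (power_sum f n s / n - \<gamma>\<^sup>2 * ?A) 0 < e"
        using R
      proof eventually_elim
        case (elim n)
        have "\<bar>power_sum f n s - birkhoff_sum G (Suc n) s\<bar>
            \<le> birkhoff_sum (D m) (Suc n) s + (birkhoff_sum F (Suc n) s - birkhoff_sum F (Suc n - m) s)"
          unfolding F_def G_def D_def
          using \<open>\<forall>i. finite (returns (seq_shift i s))\<close> by (intro power_sum_tail_estimate f) blast
        then have "\<bar>power_sum f n s - birkhoff_sum G (Suc n) s\<bar> / n
            \<le> (birkhoff_sum (D m) (Suc n) s + (birkhoff_sum F (Suc n) s - birkhoff_sum F (Suc n - m) s)) / n"
          by (rule divide_right_mono) simp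
        also have "\<dots> = ?R n"
          unfolding add_divide_distrib diff_divide_distrib by simp
        also have "\<bar>power_sum f n s - birkhoff_sum G (Suc n) s\<bar> / n
            = \<bar>power_sum f n s / n - birkhoff_sum G (Suc n) s / n\<bar>"
          unfolding diff_divide_distrib[symmetric] abs_divide by simp
        finally have "\<bar>power_sum f n s / n - birkhoff_sum G (Suc n) s / n\<bar> \<le> ?R n" .
        moreover have "\<bar>birkhoff_sum G (Suc n) s / n - \<gamma>\<^sup>2 * ?A\<bar> < e / 2"
          using elim(1) by (simp only: dist_real_def diff_zero)
        moreover note elim(2)
        ultimately have "\<bar>power_sum f n s / n - \<gamma>\<^sup>2 * ?A\<bar> < e" by linarith
        then show ?case by (simp only: dist_real_def diff_zero)
      qed
    qed
    then show ?case by (rule LIM_zero_cancel)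
  qed
qed

text \<open>The power sum is dominated by a Birkhoff sum of \<open>n + 1\<close> copies of
  \<open>F\<close>. Its fourth power is at most \<open>(n + 1) ^ 3\<close> times the Birkhoff sum of
  \<open>F ^ 4\<close>, whose mean is linear in the number of terms.\<close>

lemma power_sum_fourth_moment:
  assumes f: "mono f" "f 0 = 0" and sum: "summable (\<lambda>k. f (Suc k) ^ 4 * (1 - \<gamma>) ^ k)"
  shows "integrable S (\<lambda>s. (power_sum f n s / n) ^ 4)"
    and "(\<integral>s. (power_sum f n s / n) ^ 4 \<partial>S) \<le> 16 * (\<gamma> * (\<Sum>k. f (Suc k) ^ 4 * (1 - \<gamma>) ^ k))"
proof -
  define F where "F = (\<lambda>s :: nat \<Rightarrow> 'a. f (Suc (card (returns s))))"
  have "0 \<le> f i" for i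
    using monoD[OF f(1), of 0 i] f(2) by simp
  then have sum': "summable (\<lambda>k. \<bar>f (Suc k) ^ 4\<bar> * (1 - \<gamma>) ^ k)"
    using sum by simp
  have F4: "integrable S (\<lambda>s. F s ^ 4)"
    "(\<integral>s. F s ^ 4 \<partial>S) = \<gamma> * (\<Sum>k. f (Suc k) ^ 4 * (1 - \<gamma>) ^ k)"
    using integrable_card_returns[OF sum'] integral_card_returns[OF sum'] unfolding F_def by auto
  let ?B = "\<lambda>s. 16 / Suc n * birkhoff_sum (\<lambda>s. F s ^ 4) (Suc n) s"
  have B: "integrable S ?B"
    using F4(1) by (intro integrable_mult_right integrable_birkhoff_sum)
  have le: "AE s in S. (power_sum f n s / n) ^ 4 \<le> ?B s"
    using AE_finite_returns_seq_shift
  proof eventually_elim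
    case (elim s)
    have nonneg: "0 \<le> birkhoff_sum (\<lambda>s. F s ^ 4) (Suc n) s"
      unfolding birkhoff_sum_def by (intro sum_nonneg) simp
    show ?case
    \<comment> \<open>For \<open>n = 0\<close> division by zero makes the left side 0.\<close>
    proof (cases "n = 0")
      case False
      have "power_sum f n s ^ 4 \<le> birkhoff_sum F (Suc n) s ^ 4"
        unfolding F_def using elim by (intro power_mono power_sum_le power_sum_nonneg f) auto
      also have "\<dots> \<le> real (Suc n) ^ 3 * birkhoff_sum (\<lambda>s. F s ^ 4) (Suc n) s"
        unfolding birkhoff_sum_def using power4_sum_le[of "\<lambda>k. F (seq_shift k s)" "{..<Suc n}"]
        by (simp only: card_lessThan)
      finally have "(power_sum f n s / n) ^ 4 \<le> real (Suc n) ^ 3 / n ^ 4 * birkhoff_sum (\<lambda>s. F s ^ 4) (Suc n) s"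
        using False by (simp add: power_divide divide_right_mono)
      \<comment> \<open>The 16 is \<open>2 ^ 4\<close>, from
        \<open>n + 1 \<le> 2 * n\<close>.\<close>
      also have "real (Suc n) ^ 3 / n ^ 4 \<le> 16 / Suc n"
      proof -
        have "real (Suc n) ^ 4 \<le> (2 * real n) ^ 4"
          using False by (intro power_mono) auto
        then show ?thesis
          using False by (simp add: divide_simps power_mult_distrib eval_nat_numeral mult_ac)
      qed
      finally show ?thesis
        using nonneg by (simp add: mult_right_mono)
    qed (use nonneg in simp)
  qed
  have meas: "(\<lambda>s. (power_sum f n s / n) ^ 4) \<in> borel_measurable S"
    using power_sum_measurable[where f=f, OF f(2)] by measurable
  show int: "integrable S (\<lambda>s. (power_sum f n s / n) ^ 4)"
  proof (rule Bochner_Integration.integrable_bound[OF B meas])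
    show "AE s in S. norm ((power_sum f n s / n) ^ 4) \<le> norm (?B s)"
      using le
    proof eventually_elim
      case (elim s)
      have "norm ((power_sum f n s / n) ^ 4) = (power_sum f n s / n) ^ 4" by simp
      also note elim
      also have "?B s \<le> norm (?B s)" unfolding real_norm_def by (rule abs_ge_self)
      finally show ?case .
    qed
  qed
  have "(\<integral>s. (power_sum f n s / n) ^ 4 \<partial>S) \<le> (\<integral>s. ?B s \<partial>S)"
    using int B le by (rule integral_mono_AE)
  also have "\<dots> = 16 * (\<gamma> * (\<Sum>k. f (Suc k) ^ 4 * (1 - \<gamma>) ^ k))"
    using F4 by (simp add: integral_birkhoff_sum)
  finally show "(\<integral>s. (power_sum f n s / n) ^ 4 \<partial>S) \<le> 16 * (\<gamma> * (\<Sum>k. f (Suc k) ^ 4 * (1 - \<gamma>) ^ k))" .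
qed

end

section \<open>Transfer to the random walk\<close>

text \<open>Used to renumber the steps from 0. Injectivity turns products over a finite
  \<open>J\<close> into products over its image.\<close>

lemma (in prob_space) indep_vars_reindex:
  assumes indep: "indep_vars M' X (h ` I)" and inj: "inj_on h I"
  shows "indep_vars (\<lambda>i. M' (h i)) (\<lambda>i. X (h i)) I"
  unfolding indep_vars_def2
proof (intro conjI ballI indep_setsI)
  let ?F = "\<lambda>i. {X i -` A \<inter> space M |A. A \<in> sets (M' i)}"
  show rv: "random_variable (M' (h i)) (X (h i))" if "i \<in> I" for i
    using indep that by (auto simp: indep_vars_def2)
  show "?F (h i) \<subseteq> events" if "i \<in> I" for i
    using rv[OF that] by (auto intro: measurable_sets)
  fix A J assume J: "J \<noteq> {}" "J \<subseteq> I" "finite J" "\<forall>j\<in>J. A j \<in> ?F (h j)"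
  have inv: "inv_into I h (h j) = j" if "j \<in> J" for j
    using that J inj by (intro inv_into_f_f) auto
  have "indep_sets ?F (h ` I)"
    using indep by (simp add: indep_vars_def2)
  then have "prob (\<Inter>i\<in>h ` J. A (inv_into I h i)) = (\<Prod>i\<in>h ` J. prob (A (inv_into I h i)))"
    by (rule indep_setsD) (use J inv in auto)
  then show "prob (\<Inter>j\<in>J. A j) = (\<Prod>j\<in>J. prob (A j))"
    using inv inj_on_subset[OF inj J(2)] by (simp add: prod.reindex cong: prod.cong INF_cong)
qed

context random_walk
begin

abbreviation steps :: "'a \<Rightarrow> nat \<Rightarrow> int ^ 'd" where
  "steps \<omega> \<equiv> (\<lambda>i. X (Suc i) \<omega>)"

abbreviation step_distr :: "(int ^ 'd) measure" where
  "step_distr \<equiv> distr M (count_space UNIV) (X 1)"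

lemma random_variable_step: "1 \<le> i \<Longrightarrow> random_variable (count_space UNIV) (X i)"
  using indep by (auto simp: indep_vars_def)

lemma prob_space_step_distr: "prob_space step_distr"
  by (intro prob_space_distr random_variable_step) simp

sublocale steps: discrete_walk step_distr
  unfolding discrete_walk_def discrete_walk_axioms_def sequence_space_def
  by (intro conjI product_prob_spaceI prob_space_step_distr) simp

lemma measurable_steps [measurable]: "steps \<in> measurable M (\<Pi>\<^sub>M i\<in>UNIV. step_distr)"
proof (rule measurable_PiM_single')
  fix i :: nat
  show "(\<lambda>\<omega>. X (Suc i) \<omega>) \<in> measurable M step_distr"
    using random_variable_step[of "Suc i"] by simp
qed auto

text \<open>Independence says that the joint law is the product of the marginals, and identical
  distribution makes every marginal the law of \<open>X 1\<close>. Results about the product measure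
  thereby carry over to \<open>M\<close>.\<close>

lemma distr_steps: "distr M (\<Pi>\<^sub>M i\<in>UNIV. step_distr) steps = (\<Pi>\<^sub>M i\<in>UNIV. step_distr)"
proof -
  have "indep_vars (\<lambda>_. count_space UNIV) X (Suc ` UNIV)"
    by (rule indep_vars_subset[OF indep]) auto
  then have "indep_vars (\<lambda>_. count_space UNIV) (\<lambda>i. X (Suc i)) UNIV"
    by (rule indep_vars_reindex) simp
  then have "distr M (\<Pi>\<^sub>M i\<in>UNIV. count_space UNIV) (\<lambda>\<omega>. \<lambda>i\<in>UNIV. X (Suc i) \<omega>)
      = (\<Pi>\<^sub>M i\<in>UNIV. distr M (count_space UNIV) (X (Suc i)))"
    using random_variable_step by (subst (asm) indep_vars_iff_distr_eq_PiM') auto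
  also have "\<dots> = (\<Pi>\<^sub>M i\<in>UNIV. step_distr)"
    by (intro PiM_cong refl ident_distr) simp
  also have "distr M (\<Pi>\<^sub>M i\<in>UNIV. count_space UNIV) (\<lambda>\<omega>. \<lambda>i\<in>UNIV. X (Suc i) \<omega>)
      = distr M (\<Pi>\<^sub>M i\<in>UNIV. step_distr) steps"
    by (intro distr_cong sets_PiM_cong) (simp_all add: restrict_def)
  finally show ?thesis .
qed

lemma walk_eq_partial_sum: "walk X n \<omega> = partial_sum n (steps \<omega>)"
  unfolding walk_def partial_sum_def by (rule sum.reindex_bij_witness[of _ Suc "\<lambda>i. i - 1"]) auto

lemma escape_prob_eq: "escape_prob M X = steps.P.prob {s. returns s = {}}"
proof -
  have "{s\<in>space steps.S. \<forall>n. n \<notin> returns s} \<in> sets steps.S" by measurable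
  moreover have "{s\<in>space steps.S. \<forall>n. n \<notin> returns s} = {s. returns s = {}}"
    unfolding steps.space_S by auto
  ultimately have sets: "{s. returns s = {}} \<in> sets steps.S" by simp
  have "escape_prob M X = prob (steps -` {s. returns s = {}} \<inter> space M)"
    unfolding escape_prob_def walk_eq_partial_sum
    by (intro arg_cong[where f=prob]) (auto simp: returns_def)
  also have "\<dots> = steps.P.prob {s. returns s = {}}"
    using measure_distr[OF measurable_steps sets] unfolding distr_steps by simp
  finally show ?thesis .
qed

lemma local_time_power_sum_eq:
  "local_time_power_sum X \<alpha> n \<omega> = power_sum (\<lambda>k. real k powr \<alpha>) n (steps \<omega>)"
proof -
  have time: "local_time X n x \<omega> = card {i. i \<le> n \<and> partial_sum i (steps \<omega>) = x}" for x
  proof -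
    have "local_time X n x \<omega> = (\<Sum>i\<le>n. of_bool (partial_sum i (steps \<omega>) = x))"
      by (simp add: local_time_def walk_eq_partial_sum atMost_atLeast0)
    also have "\<dots> = card ({..n} \<inter> {i. partial_sum i (steps \<omega>) = x})"
      by (subst sum_of_bool_eq) auto
    finally show ?thesis by (simp add: Int_def)
  qed
  moreover have "{x. 0 < card {i. i \<le> n \<and> partial_sum i (steps \<omega>) = x}}
      = (\<lambda>i. partial_sum i (steps \<omega>)) ` {..n}"
    by (auto simp: card_gt_0_iff)
  ultimately show ?thesis
    unfolding local_time_power_sum_def power_sum_def by simp
qed

end

text \<open>Geometric decay beats every power, so the terms are of order at most
  \<open>1 / j ^ 2\<close>. For \<open>q = 0\<close> only the term \<open>j = 0\<close>
  survives.\<close>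

lemma summable_powr_geometric:
  fixes q \<beta> :: real
  assumes "0 \<le> q" "q < 1"
  shows "summable (\<lambda>j. real (Suc j) powr \<beta> * q ^ j)"
proof (cases "q = 0")
  case True
  then show ?thesis
    by (intro summable_finite[of "{0}"]) (auto simp: power_0_left)
next
  case False
  then have q: "0 < q" "q < 1" using assms by auto
  have "(\<lambda>j. real (Suc j) powr \<beta> * q ^ j) \<in> O(\<lambda>j. inverse (real j ^ 2))"
    using q by real_asymp
  moreover have "summable (\<lambda>j. norm (inverse (real j ^ 2)))"
    using inverse_power_summable[of 2, where ?'a=real] by simp
  ultimately show ?thesis
    by (rule summable_comparison_test_bigo[rotated])
qed

theorem corollary2:
  fixes M :: "'a measure"
    and X :: "nat \<Rightarrow> 'a \<Rightarrow> int ^ 'd::finite"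
    and \<gamma> \<alpha> c :: real
  assumes "random_walk M X"
    and "transient_walk M X"
    and "\<gamma> = escape_prob M X"
    and "\<gamma> < 1"
    and "\<alpha> \<ge> 0"
    and "c = \<gamma>\<^sup>2 * (\<Sum>j. real (Suc j) powr \<alpha> * (1 - \<gamma>) ^ j)"
  shows "summable (\<lambda>j. real (Suc j) powr \<alpha> * (1 - \<gamma>) ^ j)
    \<and> tendsto_L2 M (\<lambda>n \<omega>. local_time_power_sum X \<alpha> n \<omega> / real n) (\<lambda>\<omega>. c)
    \<and> (AE \<omega> in M. (\<lambda>n. local_time_power_sum X \<alpha> n \<omega> / real n) \<longlonglongrightarrow> c)"
proof -
  interpret random_walk M X by fact
  interpret steps: transient_discrete_walk step_distr \<gamma>
    using assms(2,3) escape_prob_eq by unfold_locales (simp_all add: transient_walk_def)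
  define f where "f = (\<lambda>k :: nat. real k powr \<alpha>)"
  have f: "mono f" "f 0 = 0"
    using \<open>\<alpha> \<ge> 0\<close> by (auto simp: f_def intro!: monoI powr_mono2)
  have summable_f: "summable (\<lambda>k. f (Suc k) * (1 - \<gamma>) ^ k)"
    unfolding f_def using steps.gamma_pos steps.gamma_le_1 by (intro summable_powr_geometric) auto
  \<comment> \<open>The fourth power of the weight is again a power, so the same summability result
    gives the fourth-moment bound.\<close>
  have "f (Suc k) ^ 4 = real (Suc k) powr (\<alpha> * 4)" for k
    by (simp add: f_def powr_powr[symmetric] powr_numeral)
  then have summable_f4: "summable (\<lambda>k. f (Suc k) ^ 4 * (1 - \<gamma>) ^ k)"
    using steps.gamma_pos steps.gamma_le_1 summable_powr_geometric[of "1 - \<gamma>" "\<alpha> * 4"] by simp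
  have L_eq: "local_time_power_sum X \<alpha> n \<omega> = power_sum f n (steps \<omega>)" for n \<omega>
    unfolding local_time_power_sum_eq f_def ..
  have meas_f [measurable]: "power_sum f n \<in> borel_measurable steps.S" for n
    using f(2) by (rule steps.power_sum_measurable)
  have "AE s in distr M steps.S steps. (\<lambda>n. power_sum f n s / n) \<longlonglongrightarrow> c"
    unfolding distr_steps assms(6) using steps.AE_power_sum_tendsto[OF f summable_f]
    by (simp only: f_def)
  then have AE_lim: "AE \<omega> in M. (\<lambda>n. local_time_power_sum X \<alpha> n \<omega> / real n) \<longlonglongrightarrow> c"
    unfolding L_eq by (rule AE_distrD[OF measurable_steps])
  have meas4: "(\<lambda>s. (power_sum f n s / n) ^ 4) \<in> borel_measurable steps.S" for n
    by measurable
  have "tendsto_L2 M (\<lambda>n \<omega>. local_time_power_sum X \<alpha> n \<omega> / real n) (\<lambda>\<omega>. c)"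
  proof (rule AE_tendsto_imp_L2[OF _ _ _ AE_lim])
    fix n
    show "(\<lambda>\<omega>. local_time_power_sum X \<alpha> n \<omega> / real n) \<in> borel_measurable M"
      unfolding L_eq by (intro borel_measurable_divide measurable_compose[OF measurable_steps meas_f]) simp
    show "integrable M (\<lambda>\<omega>. (local_time_power_sum X \<alpha> n \<omega> / real n) ^ 4)"
      unfolding L_eq using integrable_distr_eq[OF measurable_steps meas4]
        steps.power_sum_fourth_moment(1)[OF f summable_f4] unfolding distr_steps by blast
    show "(\<integral>\<omega>. (local_time_power_sum X \<alpha> n \<omega> / real n) ^ 4 \<partial>M)
        \<le> 16 * (\<gamma> * (\<Sum>k. f (Suc k) ^ 4 * (1 - \<gamma>) ^ k))"
      unfolding L_eq using integral_distr[OF measurable_steps meas4, of n]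
        steps.power_sum_fourth_moment(2)[OF f summable_f4, of n] unfolding distr_steps by simp
  qed
  with AE_lim summable_f show ?thesis
    by (simp only: f_def)
qed

end
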